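(* Let $N\ge 1$, let $\mathbf a=(a_i)_{i=1}^s$ be any sequence of block addresses with a working set of size at most $N$ (that is, at most $N$ distinct addresses occur in $\mathbf a$). Consider the non-recursive Path ORAM $\mathsf{ORAM}_L^5$ with bucket size $Z=5$ and tree height $L=\lceil \log_2 N\rceil$. Then for every stash size $R$ (a non-negative integer), the probability of a Path ORAM failure after a sequence $\mathbf s=(\mathbf a,\mathbf x,\mathbf y)$ of load/store operations corresponding to $\mathbf a$ satisfies $$\Pr\big(\mathsf{st}(\mathsf{ORAM}_L^5[\mathbf s])>R \,\big|\, a(\mathbf s)=\mathbf a\big)\le 14\cdot(0.6002)^R,$$ where the probability is over the randomness that determines $\mathbf x$ and $\mathbf y$.
   Context: Path ORAM $\mathsf{ORAM}_L^Z$. There is a complete binary tree of height $L$ with levels $0$ (root) to $L$ (leaves) and leaves labelled $0,\dots,2^L-1$. Each node is a bucket holding at most $Z$ (real) blocks. $\mathcal P(x)$ is the set of buckets on the path from leaf $x$ to the root, and $\mathcal P(x,\ell)$ is the bucket of $\mathcal P(x)$ at level $\ell$. There is also a stash $S$, a set of blocks of unlimited size. Every block address has a current leaf label. Initially all buckets and the stash are empty. A load/store operation is a triple $(a,x,y)$, where $a$ is a block address, $x$ is the current label of $a$, and $y$ is its new label. It is executed as follows: (1) the label of $a$ becomes $y$; (2) all blocks stored in the buckets of $\mathcal P(x)$ are moved into $S$, and if $a$ was never accessed before, block $a$ is created and put in $S$ (at each time there is exactly one block per address accessed so far); (3) for $\ell=L,L-1,\dots,0$ in this order, let $S'$ be the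 set of blocks in $S$ whose current label $x'$ satisfies $\mathcal P(x',\ell)=\mathcal P(x,\ell)$, and move (an arbitrary choice of) $\min(|S'|,Z)$ blocks of $S'$ from $S$ into the bucket $\mathcal P(x,\ell)$. A sequence of load/store operations is $\mathbf s=(\mathbf a,\mathbf x,\mathbf y)$ with $\mathbf a=(a_i)_{i=1}^s$, $\mathbf x=(x_i)_{i=1}^s$, $\mathbf y=(y_i)_{i=1}^s$; we write $a(\mathbf s)=\mathbf a$. Index $1$ is the most recent operation and index $s$ the oldest, so the operations $(a_i,x_i,y_i)$ are executed in the order $i=s,s-1,\dots,1$ starting from the empty ORAM. Randomness: the labels $y_i$ are independent and uniform in $\{0,\dots,2^L-1\}$; $x_i$ is the label of $a_i$ just before operation $i$, i.e. $x_i=y_j$ for the smallest $j>i$ with $a_j=a_i$ if such $j$ exists, and otherwise $x_i$ is a fresh independent uniform label. $\mathsf{ORAM}_L^Z[\mathbf s]$ is the resulting configuration of blocks in buckets and stash, and $\mathsf{st}(\mathsf{ORAM}_L^Z[\mathbf s])$ is the number of blocks in the stash after all operations of $\mathbf s$ have been executed. With a stash of size $R$, failure after $\mathbf s$ means $\mathsf{st}(\mathsf{ORAM}_L^Z[\mathbf s])>R$. *)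

theory Defs
  imports "HOL-Probability.Probability" "HOL-Probability.Product_PMF"
begin

text \<open>
  A node of the complete binary tree of height \<open>L\<close> is a pair (level, position within the level).
  The ancestor of leaf \<open>x < 2 ^ L\<close> at level \<open>l \<le> L\<close> has position \<open>x div 2 ^ (L - l)\<close>.
\<close>

type_synonym node = "nat \<times> nat"

definition path_node :: "nat \<Rightarrow> nat \<Rightarrow> nat \<Rightarrow> node" where
  "path_node L x l = (l, x div 2 ^ (L - l))"

definition path :: "nat \<Rightarrow> nat \<Rightarrow> node set" where
  "path L x = path_node L x ` {0..L}"

text \<open>
  There is exactly one block per accessed address and its contents play no role, so a block is
  identified with its address. The value \<open>None\<close> of \<open>label\<close> marks the addresses that have not been
  accessed so far; these have no block, and their label is only revealed by their first operation.
\<close>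

record 'a config =
  bucket :: "node \<Rightarrow> 'a set"
  stash :: "'a set"
  label :: "'a \<Rightarrow> nat option"

definition empty_config :: "'a config" where
  "empty_config = \<lparr>bucket = (\<lambda>_. {}), stash = {}, label = (\<lambda>_. None)\<rparr>"

text \<open>
  The operation \<open>(a, x, y)\<close> accesses address \<open>a\<close> with current label \<open>x\<close> and new label \<open>y\<close>.
\<close>

type_synonym 'a operation = "'a \<times> nat \<times> nat"

definition read_path :: "nat \<Rightarrow> 'a operation \<Rightarrow> 'a config \<Rightarrow> 'a config" where
  "read_path L = (\<lambda>(a, x, y) c.
     \<lparr>bucket = (\<lambda>v. if v \<in> path L x then {} else bucket c v),
      stash = stash c \<union> (\<Union>v\<in>path L x. bucket c v) \<union> (if label c a = None then {a} else {}),
      label = (label c)(a \<mapsto> y)\<rparr>)"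

definition eligible :: "nat \<Rightarrow> nat \<Rightarrow> nat \<Rightarrow> 'a config \<Rightarrow> 'a set" where
  "eligible L x l c =
     {b \<in> stash c. \<exists>x'. label c b = Some x' \<and> path_node L x' l = path_node L x l}"

text \<open>
  The choice of the blocks that are written back is arbitrary. The functions below therefore return
  the set of all configurations that can result.
\<close>

definition evict_level :: "nat \<Rightarrow> nat \<Rightarrow> nat \<Rightarrow> nat \<Rightarrow> 'a config \<Rightarrow> 'a config set" where
  "evict_level L Z x l c =
     {c\<lparr>bucket := (bucket c)(path_node L x l := bucket c (path_node L x l) \<union> B),
        stash := stash c - B\<rparr> | B.
        B \<subseteq> eligible L x l c \<and> card B = min (card (eligible L x l c)) Z}"

fun evict_levels :: "nat \<Rightarrow> nat \<Rightarrow> nat \<Rightarrow> nat list \<Rightarrow> 'a config \<Rightarrow> 'a config set" where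
  "evict_levels L Z x [] c = {c}"
| "evict_levels L Z x (l # ls) c = (\<Union>c'\<in>evict_level L Z x l c. evict_levels L Z x ls c')"

definition access :: "nat \<Rightarrow> nat \<Rightarrow> 'a operation \<Rightarrow> 'a config \<Rightarrow> 'a config set" where
  "access L Z = (\<lambda>(a, x, y) c. evict_levels L Z x (rev [0..<Suc L]) (read_path L (a, x, y) c))"

text \<open>
  The head of the list is the most recent operation.
\<close>

fun path_oram :: "nat \<Rightarrow> nat \<Rightarrow> 'a operation list \<Rightarrow> 'a config set" where
  "path_oram L Z [] = {empty_config}"
| "path_oram L Z (op # ops) = (\<Union>c\<in>path_oram L Z ops. access L Z op c)"

definition stash_usage :: "'a config \<Rightarrow> nat" where
  "stash_usage c = card (stash c)"

text \<open>
  Every execution can be completed, so statements about all elements of \<open>path_oram L Z ops\<close> are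
  not vacuous.
\<close>

lemma evict_level_nonempty: "evict_level L Z x l c \<noteq> {}"
proof -
  obtain B where "B \<subseteq> eligible L x l c" "card B = min (card (eligible L x l c)) Z"
    by (rule obtain_subset_with_card_n[of "min (card (eligible L x l c)) Z" "eligible L x l c"]) auto
  then show ?thesis
    unfolding evict_level_def by blast
qed

lemma evict_levels_nonempty: "evict_levels L Z x ls c \<noteq> {}"
  by (induction ls arbitrary: c) (auto simp: evict_level_nonempty)

lemma path_oram_nonempty: "path_oram L Z ops \<noteq> {}"
  by (induction ops) (auto simp: access_def evict_levels_nonempty evict_level_nonempty)

text \<open>
  The addresses are \<open>a 1, \<dots>, a s\<close>, with \<open>a 1\<close> accessed last; \<open>y i\<close> is the new label in operation
  \<open>i\<close>, and \<open>f i\<close> is the fresh label that is used if operation \<open>i\<close> is the first access to \<open>a i\<close>.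
\<close>

definition old_label ::
    "nat \<Rightarrow> (nat \<Rightarrow> 'a) \<Rightarrow> (nat \<Rightarrow> nat) \<Rightarrow> (nat \<Rightarrow> nat) \<Rightarrow> nat \<Rightarrow> nat" where
  "old_label s a y f i =
     (if \<exists>j. i < j \<and> j \<le> s \<and> a j = a i
      then y (LEAST j. i < j \<and> j \<le> s \<and> a j = a i)
      else f i)"

definition random_labels :: "nat \<Rightarrow> nat \<Rightarrow> (nat \<Rightarrow> nat) pmf" where
  "random_labels L s = Pi_pmf {1..s} 0 (\<lambda>_. pmf_of_set {0..<2 ^ L})"

definition random_operations :: "nat \<Rightarrow> nat \<Rightarrow> (nat \<Rightarrow> 'a) \<Rightarrow> 'a operation list pmf" where
  "random_operations L s a =
     map_pmf (\<lambda>(y, f). map (\<lambda>i. (a i, old_label s a y f i, y i)) [1..<Suc s])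
       (pair_pmf (random_labels L s) (random_labels L s))"

end

theory Submission
  imports Defs
begin

text \<open>
  Compare with a Path ORAM with buckets of unlimited size. There, a block \<open>b\<close> with last access
  \<open>i\<close>, sits at the deepest node of the path to \<open>y\<^sub>i\<close> that is visited by one of the read paths
  \<open>x\<^sub>1, \<dots>, x\<^sub>i\<close>. Let \<open>T\<close> be the rooted subtree of the full nodes all of whose ancestors are full. The
  blocks in the stash and in the buckets of \<open>T\<close> are in \<open>T\<close> in the unlimited ORAM as well, hence that
  ORAM holds at least \<open>5 |T| + st\<close> blocks in \<open>T\<close>.

  A block is in \<open>T\<close> in the unlimited ORAM iff \<open>y\<^sub>i\<close> is a leaf in \<open>T\<close> or the path to \<open>y\<^sub>i\<close> exits \<open>T\<close> at
  a node that is not visited by \<open>x\<^sub>1, \<dots>, x\<^sub>i\<close>. The labels \<open>x\<^sub>j\<close>, for all \<open>j\<close>, and \<open>y\<^sub>i\<close>, for the last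
  accesses \<open>i\<close>, are independent and uniform. With the potential \<open>3 ^ k\<close>, where \<open>k\<close> is the number of
  exits not yet visited, the expectation of \<open>(5/3) ^ u\<close> for the number \<open>u\<close> of blocks in \<open>T\<close> is at most
  \<open>3 ^ (|T| + 1)\<close>. So the probability of \<open>u > 5 |T| + R\<close> is at most
  \<open>9/5 (3/5) ^ R (3 (3/5) ^ 5) ^ |T|\<close>, and the sum over all \<open>T\<close> converges since \<open>3 (3/5) ^ 5 < 1/4\<close>.
\<close>

subsection \<open>Comparison with unlimited buckets\<close>

lemma path_node_eq_mono:
  assumes "path_node L x l = path_node L y l" "k \<le> l" "l \<le> L"
  shows "path_node L x k = path_node L y k"
proof -
  have "z div 2 ^ (L - k) = z div 2 ^ (L - l) div 2 ^ (l - k)" for z :: nat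
    using assms(2,3) by (simp add: div_mult2_eq[symmetric] power_add[symmetric])
  then show ?thesis
    using assms(1) unfolding path_node_def by (metis prod.inject)
qed

lemma path_node_0: "x < 2 ^ L \<Longrightarrow> path_node L x 0 = (0, 0)"
  by (simp add: path_node_def)

lemma path_node_Suc_cases:
  assumes "l < L" "path_node L y l = (l, p)"
  shows "path_node L y (Suc l) = (Suc l, 2 * p) \<or> path_node L y (Suc l) = (Suc l, 2 * p + 1)"
proof -
  have "y div 2 ^ (L - l) = y div 2 ^ (L - Suc l) div 2"
    using assms(1) by (simp add: div_mult2_eq[symmetric] Suc_diff_Suc flip: power_Suc2)
  then have "p = (y div 2 ^ (L - Suc l)) div 2"
    using assms(2) by (simp add: path_node_def)
  then show ?thesis
    by (auto simp: path_node_def)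
qed

lemma path_node_in_path_iff: "l \<le> L \<Longrightarrow> path_node L z l \<in> path L x \<longleftrightarrow> path_node L z l = path_node L x l"
  by (auto simp: path_def path_node_def)

text \<open>
  Where the block \<open>b\<close> with label \<open>z\<close> would be if buckets were unlimited: at the deepest level \<open>l\<close> with
  \<open>touches L ops b z l\<close>.
\<close>

fun touches :: "nat \<Rightarrow> 'a operation list \<Rightarrow> 'a \<Rightarrow> nat \<Rightarrow> nat \<Rightarrow> bool" where
  "touches L [] b z l = False"
| "touches L ((a, x, y) # ops) b z l =
     (path_node L x l = path_node L z l \<or> b \<noteq> a \<and> touches L ops b z l)"

lemma touches_mono: "touches L ops b z l \<Longrightarrow> k \<le> l \<Longrightarrow> l \<le> L \<Longrightarrow> touches L ops b z k"
  by (induction ops) (auto dest: path_node_eq_mono)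

text \<open>\<open>map_of\<close> returns the first match and the list starts with the most recent
  operation, so these are the current labels of the accessed addresses.\<close>

definition new_labels :: "'a operation list \<Rightarrow> 'a \<Rightarrow> nat option" where
  "new_labels ops = map_of (map (\<lambda>(a, x, y). (a, y)) ops)"

lemma new_labels_simps [simp]:
  "new_labels [] = Map.empty"
  "new_labels ((a, x, y) # ops) = (new_labels ops)(a \<mapsto> y)"
  by (auto simp: new_labels_def)

text \<open>The label read by an operation is forced only if its address was accessed before; a
  first access reads a fresh label, which stays free.\<close>

fun consistent :: "'a operation list \<Rightarrow> bool" where
  "consistent [] = True"
| "consistent ((a, x, y) # ops) = ((\<forall>z. new_labels ops a = Some z \<longrightarrow> z = x) \<and> consistent ops)"

text \<open>The decisive clause is \<open>full\<close>. Write-back is greedy from the leaf upwards,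
  so a block that came within reach of a bucket and still lies above it was left out only because
  the bucket was filled. The other clauses say where blocks can be and that none is stored
  twice.\<close>

locale oram_inv =
  fixes L Z :: nat and ops :: "'a operation list" and c :: "'a config"
  assumes label_eq: "label c = new_labels ops"
    and stash_dom: "stash c \<subseteq> dom (label c)"
    and bucket_path: "b \<in> bucket c v \<Longrightarrow>
      \<exists>z l. label c b = Some z \<and> l \<le> L \<and> v = path_node L z l \<and> touches L ops b z l"
    and stash_disjoint: "stash c \<inter> bucket c v = {}"
    and bucket_disjoint: "v \<noteq> w \<Longrightarrow> bucket c v \<inter> bucket c w = {}"
    and full: "label c b = Some z \<Longrightarrow> l \<le> L \<Longrightarrow> touches L ops b z l \<Longrightarrow>
      b \<in> stash c \<or> (\<exists>k<l. b \<in> bucket c (path_node L z k)) \<Longrightarrow>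
      Z \<le> card (bucket c (path_node L z l))"

text \<open>The state in the middle of a write-back: \<open>c0\<close> is the configuration after
  the path to \<open>x\<close> has been read, the levels from \<open>n\<close> on have been
  refilled, and the levels \<open>k < n\<close> are still empty. \<open>greedy\<close> is the clause
  \<open>full\<close> of \<open>oram_inv\<close> on this path.\<close>

locale evict_inv =
  fixes L Z x :: nat and c0 :: "'a config" and n :: nat and c :: "'a config"
  assumes label_eq: "label c = label c0"
    and off_path: "v \<notin> path L x \<Longrightarrow> bucket c v = bucket c0 v"
    and pending: "k < n \<Longrightarrow> bucket c (path_node L x k) = {}"
    and stash_mono: "stash c \<subseteq> stash c0"
    and bucket_from_stash: "v \<in> path L x \<Longrightarrow> bucket c v \<subseteq> stash c0 - stash c"
    and bucket_path: "k \<le> L \<Longrightarrow> b \<in> bucket c (path_node L x k) \<Longrightarrow>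
      \<exists>z. label c0 b = Some z \<and> path_node L z k = path_node L x k"
    and bucket_disjoint: "v \<in> path L x \<Longrightarrow> w \<in> path L x \<Longrightarrow> v \<noteq> w \<Longrightarrow>
      bucket c v \<inter> bucket c w = {}"
    and greedy: "label c0 b = Some z \<Longrightarrow> n \<le> k \<Longrightarrow> k \<le> L \<Longrightarrow> path_node L z k = path_node L x k \<Longrightarrow>
      b \<in> stash c \<or> (\<exists>j<k. b \<in> bucket c (path_node L x j)) \<Longrightarrow>
      Z \<le> card (bucket c (path_node L x k))"

lemma path_node_eq_iff_level [simp]: "path_node L x k = path_node L x j \<longleftrightarrow> k = j"
  by (auto simp: path_node_def)

lemma path_node_in_path [simp]: "k \<le> L \<Longrightarrow> path_node L x k \<in> path L x"
  by (auto simp: path_def)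

lemma in_pathE:
  assumes "v \<in> path L x"
  obtains k where "k \<le> L" "v = path_node L x k"
  using assms by (auto simp: path_def)

lemma evict_inv_step:
  assumes inv: "evict_inv L Z x c0 (Suc n) c" and n: "n \<le> L"
    and c': "c' \<in> evict_level L Z x n c" and fin: "finite (stash c0)"
  shows "evict_inv L Z x c0 n c'"
proof -
  obtain B where B: "B \<subseteq> eligible L x n c" "card B = min (card (eligible L x n c)) Z"
    and c'_eq: "c' = c\<lparr>bucket := (bucket c)(path_node L x n := bucket c (path_node L x n) \<union> B),
        stash := stash c - B\<rparr>"
    using c' by (auto simp: evict_level_def)
  interpret evict_inv L Z x c0 "Suc n" c by (rule inv)
  note lab = label_eq and off = off_path and emp = pending and st = stash_mono
    and bst = bucket_from_stash and on = bucket_path and disj = bucket_disjoint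
  have Bst: "B \<subseteq> stash c"
    using B(1) by (auto simp: eligible_def)
  have bn: "bucket c' (path_node L x n) = B"
    using emp[of n] by (simp add: c'_eq)
  have bk: "bucket c' v = bucket c v" if "v \<noteq> path_node L x n" for v
    using that by (simp add: c'_eq)
  have st': "stash c' = stash c - B" and lab': "label c' = label c0"
    using lab by (auto simp: c'_eq)
  have fine: "finite (eligible L x n c)"
    using fin st by (auto simp: eligible_def intro: finite_subset)
  have greedy': "Z \<le> card (bucket c' (path_node L x k))"
    if b: "label c0 b = Some z" "n \<le> k" "k \<le> L" "path_node L z k = path_node L x k"
      "b \<in> stash c' \<or> (\<exists>j<k. b \<in> bucket c' (path_node L x j))" for b z k
  proof (cases "k = n")
    case True
    have "b \<notin> bucket c' (path_node L x j)" if "j < k" for j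
      using that True emp[of j] bk[of "path_node L x j"] by auto
    then have "b \<in> stash c - B"
      using b(5) st' by auto
    then have "b \<in> eligible L x n c - B"
      using b True by (auto simp: eligible_def lab)
    \<comment> \<open>An eligible block is left over, so the minimum that determines
      \<open>card B\<close> is \<open>Z\<close>.\<close>
    then have "card B < card (eligible L x n c)"
      using B(1) fine by (intro psubset_card_mono) auto
    then show ?thesis
      using B(2) bn True by auto
  next
    case False
    \<comment> \<open>A block that has just been put into level \<open>n < k\<close> was in the
      stash before, so the premise already held for \<open>c\<close>.\<close>
    have "b \<in> stash c \<or> (\<exists>j<k. b \<in> bucket c (path_node L x j))"
      using b(5) st' bn bk Bst by (metis DiffD1 subsetD)
    then show ?thesis
      using greedy[of b z k] b False bk[of "path_node L x k"] by auto
  qed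
  show ?thesis
  proof
    show "label c' = label c0" by (rule lab')
    show "bucket c' v = bucket c0 v" if "v \<notin> path L x" for v
      using that off n by (cases "v = path_node L x n") (auto simp: bk)
    show "bucket c' (path_node L x k) = {}" if "k < n" for k
      using that emp by (auto simp: bk)
    show "stash c' \<subseteq> stash c0" using st st' by auto
    show "bucket c' v \<subseteq> stash c0 - stash c'" if "v \<in> path L x" for v
      using bst[OF that] Bst st st' bn bk by (cases "v = path_node L x n") auto
    show "\<exists>z. label c0 b = Some z \<and> path_node L z k = path_node L x k"
      if "k \<le> L" "b \<in> bucket c' (path_node L x k)" for k b
    proof (cases "k = n")
      case True
      then show ?thesis using that bn B(1) lab by (auto simp: eligible_def)
    next
      case False
      then show ?thesis using that on bk by auto
    qed
    show "bucket c' v \<inter> bucket c' w = {}" if "v \<in> path L x" "w \<in> path L x" "v \<noteq> w" for v w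
    proof -
      have *: "bucket c' u = (if u = path_node L x n then B else bucket c u)" for u
        using bn bk by simp
      have "B \<inter> bucket c v = {}" "bucket c w \<inter> B = {}"
        using bst[OF that(1)] bst[OF that(2)] Bst by blast+
      then show ?thesis
        using disj[OF that] that(3) Bst by (simp add: * Int_commute) blast
    qed
  qed (use greedy' in blast)
qed

lemma evict_inv_levels:
  assumes "evict_inv L Z x c0 n c" "n \<le> Suc L" "c' \<in> evict_levels L Z x (rev [0..<n]) c"
    and "finite (stash c0)"
  shows "evict_inv L Z x c0 0 c'"
  using assms
proof (induction n arbitrary: c)
  case (Suc n)
  then obtain c1 where "c1 \<in> evict_level L Z x n c" "c' \<in> evict_levels L Z x (rev [0..<n]) c1"
    by auto
  with Suc show ?case
    using evict_inv_step[of L Z x c0 n c c1] by auto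
qed simp

lemma evict_inv_init:
  assumes "\<And>v. v \<in> path L x \<Longrightarrow> bucket c0 v = {}"
  shows "evict_inv L Z x c0 (Suc L) c0"
  using assms by unfold_locales auto

lemma finite_new_labels: "finite (dom (new_labels ops))"
  by (simp add: new_labels_def finite_dom_map_of)

text \<open>Buckets off the path to \<open>x\<close> are unchanged, and those on it are described by
  \<open>evict_inv\<close>. For \<open>full\<close>, a bucket on the path is covered by
  \<open>greedy\<close>. For a bucket off it, the reach of the block dates from before this access,
  and \<open>full\<close> for the old configuration applies once the block is known to have been
  above that bucket already.\<close>

lemma oram_inv_access:
  assumes inv: "oram_inv L Z ops c" and cons: "consistent ((a, x, y) # ops)"
    and c': "c' \<in> access L Z (a, x, y) c"
  shows "oram_inv L Z ((a, x, y) # ops) c'"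
proof -
  define c0 where "c0 = read_path L (a, x, y) c"
  interpret oram_inv L Z ops c by (rule inv)
  note lab = label_eq and sdom = stash_dom and bpath = bucket_path and sdisj = stash_disjoint
    and bdisj = bucket_disjoint
  \<comment> \<open>The path to the current label of \<open>a\<close> is read, so no copy of
    \<open>a\<close> remains off the path under an outdated label.\<close>
  have ax: "z = x" if "label c a = Some z" for z
    using cons that lab by auto
  have b0: "bucket c0 v = (if v \<in> path L x then {} else bucket c v)"
    and s0: "stash c0 = stash c \<union> (\<Union>v\<in>path L x. bucket c v) \<union> (if label c a = None then {a} else {})"
    and l0: "label c0 = (label c)(a \<mapsto> y)" for v
    by (auto simp: c0_def read_path_def)
  have s0dom: "stash c0 \<subseteq> dom (label c0)"
    using sdom bpath by (auto simp: s0 l0 split: if_splits) blast+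
  moreover have "finite (dom (label c0))"
    using finite_new_labels[of ops] by (simp add: l0 lab)
  ultimately have fin: "finite (stash c0)"
    by (rule finite_subset)
  interpret e: evict_inv L Z x c0 0 c'
    using c' fin evict_inv_levels[OF evict_inv_init, of L x c0 c' Z]
    by (simp add: access_def c0_def[symmetric] b0 del: upt_Suc)
  note lab' = e.label_eq and off0 = e.off_path and st = e.stash_mono
    and bst = e.bucket_from_stash and on = e.bucket_path and disj = e.bucket_disjoint
    and greedy = e.greedy[OF _ le0]
  have off: "bucket c' v = bucket c v" if "v \<notin> path L x" for v
    using off0[OF that] that by (simp add: b0)
  have a_off: "a \<notin> bucket c v" if "v \<notin> path L x" for v
    using bpath[of a v] ax that by (auto simp: path_def)
  have s0_off: "stash c0 \<inter> bucket c v = {}" if "v \<notin> path L x" for v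
  proof -
    have "bucket c w \<inter> bucket c v = {}" if "w \<in> path L x" for w
      using that \<open>v \<notin> path L x\<close> by (intro bdisj) blast
    then show ?thesis
      using sdisj[of v] a_off[OF that] unfolding s0 by (simp add: Int_Un_distrib2) blast
  qed
  show ?thesis
  proof
    show "label c' = new_labels ((a, x, y) # ops)"
      by (simp add: lab' l0 lab)
    show "stash c' \<subseteq> dom (label c')"
      using st s0dom lab' by auto
    show "\<exists>z l. label c' b = Some z \<and> l \<le> L \<and> v = path_node L z l \<and> touches L ((a, x, y) # ops) b z l"
      if b: "b \<in> bucket c' v" for v b
    proof (cases "v \<in> path L x")
      case True
      then obtain k where k: "k \<le> L" "v = path_node L x k" by (rule in_pathE)
      then obtain z where "label c0 b = Some z" "path_node L z k = path_node L x k"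
        using on[of k b] b by auto
      with k lab' show ?thesis by (intro exI[of _ z] exI[of _ k]) simp
    next
      case False
      then have "b \<in> bucket c v" "b \<noteq> a" using b off[OF False] a_off[OF False] by auto
      then show ?thesis using bpath[of b v] by (auto simp: lab' l0)
    qed
    show "stash c' \<inter> bucket c' v = {}" for v
      using bst[of v] off[of v] s0_off[of v] st by (cases "v \<in> path L x") auto
    show "bucket c' v \<inter> bucket c' w = {}" if "v \<noteq> w" for v w
    proof -
      have *: "bucket c' u \<subseteq> stash c0" if "u \<in> path L x" for u
        using bst[OF that] by blast
      consider "v \<in> path L x" "w \<in> path L x" | "v \<in> path L x" "w \<notin> path L x"
        | "v \<notin> path L x" "w \<in> path L x" | "v \<notin> path L x" "w \<notin> path L x" by blast
      then show ?thesis
      proof cases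
        case 1
        then show ?thesis using disj that by blast
      next
        case 2
        then show ?thesis using *[of v] off[of w] s0_off[of w] by blast
      next
        case 3
        then show ?thesis using *[of w] off[of v] s0_off[of v] by blast
      next
        case 4
        then show ?thesis using bdisj[OF that] off by simp
      qed
    qed
    show "Z \<le> card (bucket c' (path_node L z l))"
      if b: "label c' b = Some z" "l \<le> L" "touches L ((a, x, y) # ops) b z l"
        "b \<in> stash c' \<or> (\<exists>k<l. b \<in> bucket c' (path_node L z k))" for b z l
    proof (cases "path_node L x l = path_node L z l")
      case True
      have "b \<in> stash c' \<or> (\<exists>k<l. b \<in> bucket c' (path_node L x k))"
        using b(2,4) path_node_eq_mono[OF True] by (metis less_imp_le)
      then show ?thesis
        using greedy[of b z l] b True by (simp add: lab')
    next
      case False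
      then have ba: "b \<noteq> a" and t: "touches L ops b z l" and lb: "label c b = Some z"
        using b by (auto simp: lab' l0 split: if_splits)
      have loff: "path_node L z l \<notin> path L x"
        using False b(2) by (auto simp: path_node_in_path_iff)
      \<comment> \<open>A block picked up from the read path lay on a common ancestor of
        \<open>z\<close> and \<open>x\<close>. The two paths differ at level \<open>l\<close>, so
        this ancestor is above level \<open>l\<close>.\<close>
      have from0: "b \<in> stash c \<or> (\<exists>k<l. b \<in> bucket c (path_node L z k))" if "b \<in> stash c0"
      proof (cases "b \<in> stash c")
        case False
        then have "b \<in> (\<Union>v\<in>path L x. bucket c v)"
          using that ba unfolding s0 by (simp split: if_splits)
        then obtain v where v: "v \<in> path L x" "b \<in> bucket c v"
          by (rule UN_E)
        then obtain j where j: "j \<le> L" "v = path_node L z j"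
          using bpath[OF v(2)] lb by auto
        then have eq: "path_node L z j = path_node L x j"
          using v by (simp add: path_node_in_path_iff)
        have "j < l"
        proof (rule ccontr)
          assume "\<not> j < l"
          then have "path_node L z l = path_node L x l"
            using path_node_eq_mono[OF eq, of l] j by simp
          then show False using \<open>path_node L x l \<noteq> path_node L z l\<close> by simp
        qed
        then show ?thesis using v j by auto
      qed simp
      have "b \<in> stash c \<or> (\<exists>k<l. b \<in> bucket c (path_node L z k))"
        using b(4)
      proof
        assume "b \<in> stash c'"
        then show ?thesis using st from0 by auto
      next
        assume "\<exists>k<l. b \<in> bucket c' (path_node L z k)"
        then obtain k where k: "k < l" "b \<in> bucket c' (path_node L z k)" by auto
        show ?thesis
        proof (cases "path_node L z k \<in> path L x")
          case True
          then show ?thesis using bst[OF True] k from0 by auto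
        next
          case False
          then show ?thesis using off[OF False] k by auto
        qed
      qed
      then show ?thesis
        using full[OF lb b(2) t] off[OF loff] by simp
    qed
  qed
qed

lemma oram_inv_path_oram:
  "consistent ops \<Longrightarrow> c \<in> path_oram L Z ops \<Longrightarrow> oram_inv L Z ops c"
proof (induction ops arbitrary: c)
  case Nil
  then show ?case by unfold_locales (auto simp: empty_config_def)
next
  case (Cons op ops)
  obtain a x y where op: "op = (a, x, y)" by (metis prod_cases3)
  from Cons.prems(2) obtain c1 where "c1 \<in> path_oram L Z ops" "c \<in> access L Z op c1"
    by auto
  with Cons.IH[of c1] Cons.prems(1) show ?case
    unfolding op by (intro oram_inv_access) auto
qed

subsection \<open>Rooted subtrees and their exits\<close>

text \<open>\<open>d\<close> is the number of available levels. The empty set is included because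
  the root bucket may fail to be full.\<close>

fun rooted_subtrees :: "nat \<Rightarrow> node \<Rightarrow> node set set" where
  "rooted_subtrees 0 v = {{}}"
| "rooted_subtrees (Suc d) (l, p) = insert {}
     ((\<lambda>(A, B). insert (l, p) (A \<union> B)) ` (rooted_subtrees d (Suc l, 2 * p) \<times> rooted_subtrees d (Suc l, 2 * p + 1)))"

definition children :: "node \<Rightarrow> node set" where
  "children = (\<lambda>(l, p). {(Suc l, 2 * p), (Suc l, 2 * p + 1)})"

definition descendants :: "nat \<Rightarrow> node \<Rightarrow> node set" where
  "descendants d = (\<lambda>(l, p). {(l + k, q) | k q. k < d \<and> q div 2 ^ k = p})"

lemma descendants_child:
  assumes "(m, q) \<in> descendants d (Suc l, p')" "p' div 2 = p"
  shows "(m, q) \<in> descendants (Suc d) (l, p)"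
proof -
  obtain k where k: "m = Suc l + k" "k < d" "q div 2 ^ k = p'"
    using assms(1) by (auto simp: descendants_def)
  have "q div 2 ^ Suc k = p"
    using k(3) assms(2) by (simp only: power_Suc2 div_mult2_eq)
  then show ?thesis
    using k by (auto simp: descendants_def intro!: exI[of _ "Suc k"])
qed

lemma descendants_disjoint: "p \<noteq> q \<Longrightarrow> descendants d (l, p) \<inter> descendants d (l, q) = {}"
  by (auto simp: descendants_def)

lemma descendants_level: "(m, q) \<in> descendants d (l, p) \<Longrightarrow> l \<le> m \<and> m < l + d"
  by (auto simp: descendants_def)

lemma rooted_subtrees_SucE:
  assumes "T \<in> rooted_subtrees (Suc d) (l, p)" "T \<noteq> {}"
  obtains A B where "A \<in> rooted_subtrees d (Suc l, 2 * p)" "B \<in> rooted_subtrees d (Suc l, 2 * p + 1)"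
    "T = insert (l, p) (A \<union> B)"
  using assms by auto

lemma subtree_descendants: "T \<in> rooted_subtrees d v \<Longrightarrow> T \<subseteq> descendants d v"
proof (induction d v arbitrary: T rule: rooted_subtrees.induct)
  case (2 d l p)
  show ?case
  proof (cases "T = {}")
    case False
    with "2.prems" obtain A B where AB: "A \<in> rooted_subtrees d (Suc l, 2 * p)" "B \<in> rooted_subtrees d (Suc l, 2 * p + 1)"
      "T = insert (l, p) (A \<union> B)" by (rule rooted_subtrees_SucE)
    have "A \<subseteq> descendants (Suc d) (l, p)" "B \<subseteq> descendants (Suc d) (l, p)"
      using "2.IH"(1)[OF AB(1)] "2.IH"(2)[OF AB(2)] by (auto intro: descendants_child)
    moreover have "(l, p) \<in> descendants (Suc d) (l, p)"
      by (auto simp: descendants_def)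
    ultimately show ?thesis using AB(3) by blast
  qed simp
qed simp

lemma finite_subtree: "T \<in> rooted_subtrees d v \<Longrightarrow> finite T"
  by (induction d v arbitrary: T rule: rooted_subtrees.induct) auto

lemma finite_subtrees: "finite (rooted_subtrees d v)"
  by (induction d v rule: rooted_subtrees.induct) auto

lemma subtree_parent_closed: "T \<in> rooted_subtrees d v \<Longrightarrow> T \<subseteq> insert v (\<Union> (children ` T))"
proof (induction d v arbitrary: T rule: rooted_subtrees.induct)
  case (2 d l p)
  show ?case
  proof (cases "T = {}")
    case False
    with "2.prems" obtain A B where AB: "A \<in> rooted_subtrees d (Suc l, 2 * p)" "B \<in> rooted_subtrees d (Suc l, 2 * p + 1)"
      "T = insert (l, p) (A \<union> B)" by (rule rooted_subtrees_SucE)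
    show ?thesis
      using "2.IH"(1)[OF AB(1)] "2.IH"(2)[OF AB(2)] by (simp add: AB(3) children_def) blast
  qed simp
qed simp

text \<open>
  Writing \<open>S\<close> for the generating function of the rooted subtrees at height \<open>d\<close> (with the empty one),
  \<open>S\<close> at height \<open>d + 1\<close> is \<open>1 + w S\<^sup>2\<close>, and 2 is a fixed point of \<open>S \<mapsto> 1 + S\<^sup>2 / 4\<close>.
\<close>

lemma sum_subtrees_le:
  fixes w :: real
  assumes w: "0 \<le> w" "w \<le> 1 / 4"
  shows "(\<Sum>T\<in>rooted_subtrees d v. w ^ card T) \<le> 2"
proof (induction d v rule: rooted_subtrees.induct)
  case (2 d l p)
  let ?l = "rooted_subtrees d (Suc l, 2 * p)" and ?r = "rooted_subtrees d (Suc l, 2 * p + 1)"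
  let ?j = "\<lambda>(A, B). insert (l, p) (A \<union> B)"
  have card_join: "card (?j (A, B)) = Suc (card A + card B)" if "A \<in> ?l" "B \<in> ?r" for A B
  proof -
    have sub: "A \<subseteq> descendants d (Suc l, 2 * p)" "B \<subseteq> descendants d (Suc l, 2 * p + 1)"
      using that by (auto dest: subtree_descendants)
    then have "A \<inter> B = {}"
      using descendants_disjoint[of "2 * p" "2 * p + 1" d "Suc l"] by fastforce
    moreover have "(l, p) \<notin> A \<union> B"
      using sub by (auto dest!: subsetD[where c = "(l, p)"] descendants_level)
    ultimately show ?thesis
      using that by (simp add: finite_subtree card_Un_disjoint)
  qed
  have "(\<Sum>T\<in>?j ` (?l \<times> ?r). w ^ card T) \<le> (\<Sum>X\<in>?l \<times> ?r. w ^ card (?j X))"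
    using sum_image_le[of "?l \<times> ?r" "\<lambda>T. w ^ card T" ?j] w by (simp add: finite_subtrees o_def)
  also have "\<dots> = (\<Sum>X\<in>?l \<times> ?r. w * (w ^ card (fst X) * w ^ card (snd X)))"
    using card_join by (intro sum.cong) (auto simp: power_add)
  also have "\<dots> = w * ((\<Sum>A\<in>?l. w ^ card A) * (\<Sum>B\<in>?r. w ^ card B))"
    unfolding sum_product sum.cartesian_product by (simp add: case_prod_unfold flip: sum_distrib_left)
  \<comment> \<open>The nonempty subtrees contribute at most 1, and the empty one contributes the
    other 1.\<close>
  also have "\<dots> \<le> 1 / 4 * (2 * 2)"
    using w 2 by (intro mult_mono) (auto intro!: sum_nonneg mult_nonneg_nonneg)
  finally have "(\<Sum>T\<in>?j ` (?l \<times> ?r). w ^ card T) \<le> 1" by simp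
  then show ?case
    using finite_subtrees by (simp add: sum.insert_if)
qed simp

text \<open>The largest rooted subtree with at most \<open>d\<close> levels all of whose nodes
  satisfy \<open>P\<close>.\<close>

fun grow :: "(node \<Rightarrow> bool) \<Rightarrow> nat \<Rightarrow> node \<Rightarrow> node set" where
  "grow P 0 v = {}"
| "grow P (Suc d) (l, p) = (if P (l, p)
     then insert (l, p) (grow P d (Suc l, 2 * p) \<union> grow P d (Suc l, 2 * p + 1)) else {})"

lemma grow_subtree: "grow P d v \<in> rooted_subtrees d v"
proof (induction P d v rule: grow.induct)
  case (2 P d l p)
  then show ?case
    by (auto intro!: image_eqI[where x = "(grow P d (Suc l, 2 * p), grow P d (Suc l, 2 * p + 1))"])
qed simp

lemma grow_holds: "v \<in> grow P d u \<Longrightarrow> P v"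
  by (induction P d u rule: grow.induct) (auto split: if_splits)

text \<open>Exactly one child of \<open>(l, p)\<close> is on the path to \<open>y\<close>, and the
  branches below different children are disjoint, so only the nodes of the path matter.
  \<open>l + d = Suc L\<close> lets the growth reach the leaf level \<open>L\<close>.\<close>

lemma path_node_in_grow_iff:
  assumes "l + d = Suc L" "path_node L y l = (l, p)" "l \<le> k" "k \<le> L"
  shows "path_node L y k \<in> grow P d (l, p) \<longleftrightarrow> (\<forall>j\<in>{l..k}. P (path_node L y j))"
  using assms
proof (induction d arbitrary: l p)
  case (Suc d)
  show ?case
  proof (cases "k = l")
    case True
    have "(l, p) \<notin> grow P d (Suc l, q)" for q
      using subtree_descendants[OF grow_subtree[of P d "(Suc l, q)"]] by (auto dest!: subsetD descendants_level)
    then show ?thesis using Suc.prems True by simp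
  next
    case False
    then have "l < L" and lk: "Suc l \<le> k" using Suc.prems by auto
    then obtain q where q: "q = 2 * p \<or> q = 2 * p + 1" "path_node L y (Suc l) = (Suc l, q)"
      using path_node_Suc_cases Suc.prems(2) by blast
    have IH: "path_node L y k \<in> grow P d (Suc l, q) \<longleftrightarrow> (\<forall>j\<in>{Suc l..k}. P (path_node L y j))"
      using Suc.IH[of "Suc l" q] Suc.prems lk q(2) by simp
    have "path_node L y k \<in> descendants d (Suc l, q)"
    proof -
      have "y div 2 ^ (L - k) div 2 ^ (k - Suc l) = y div 2 ^ (L - Suc l)"
        using lk Suc.prems by (simp add: div_mult2_eq[symmetric] power_add[symmetric])
      then show ?thesis
        using q(2) lk Suc.prems by (auto simp: descendants_def path_node_def intro!: exI[of _ "k - Suc l"])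
    qed
    then have "path_node L y k \<notin> grow P d (Suc l, q')" if "q' \<noteq> q" for q'
      using subtree_descendants[OF grow_subtree[of P d "(Suc l, q')"]] descendants_disjoint[OF that, of d "Suc l"]
      by blast
    then have "path_node L y k \<in> grow P d (Suc l, 2 * p) \<union> grow P d (Suc l, 2 * p + 1) \<longleftrightarrow>
        path_node L y k \<in> grow P d (Suc l, q)"
      using q(1) by (metis Un_iff)
    moreover have "path_node L y k \<noteq> (l, p)"
      using False by (simp add: path_node_def)
    moreover have "{l..k} = insert l {Suc l..k}"
      using Suc.prems by auto
    ultimately show ?thesis
      using IH Suc.prems(2) by auto
  qed
qed simp

text \<open>
  If the whole path to \<open>y\<close> is in \<open>T\<close>, then the exit node of \<open>y\<close> is the nonexistent node \<open>(L + 1, y)\<close>.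
\<close>

definition exit_node :: "nat \<Rightarrow> node set \<Rightarrow> nat \<Rightarrow> node" where
  "exit_node L T y = path_node L y (LEAST k. path_node L y k \<notin> T)"

definition inner_leaves :: "nat \<Rightarrow> node set \<Rightarrow> nat set" where
  "inner_leaves L T = {y. y < 2 ^ L \<and> (\<forall>k\<le>L. path_node L y k \<in> T)}"

definition exits :: "nat \<Rightarrow> node set \<Rightarrow> node set" where
  "exits L T = exit_node L T ` ({..<2 ^ L} - inner_leaves L T)"

lemma exit_nodeE:
  assumes T: "T \<in> rooted_subtrees (Suc L) (0, 0)" and y: "y < 2 ^ L" "y \<notin> inner_leaves L T"
  obtains k where "k \<le> L" "exit_node L T y = path_node L y k" "path_node L y k \<notin> T"
    "k = 0 \<or> path_node L y (k - 1) \<in> T"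
proof
  let ?k = "LEAST k. path_node L y k \<notin> T"
  obtain j where j: "j \<le> L" "path_node L y j \<notin> T"
    using y by (auto simp: inner_leaves_def)
  show "?k \<le> L"
    using Least_le[of "\<lambda>k. path_node L y k \<notin> T" j] j by simp
  show "exit_node L T y = path_node L y ?k"
    by (simp add: exit_node_def)
  show "path_node L y ?k \<notin> T"
    using LeastI[of "\<lambda>k. path_node L y k \<notin> T" j] j by simp
  show "?k = 0 \<or> path_node L y (?k - 1) \<in> T"
    using not_less_Least[of "?k - 1" "\<lambda>k. path_node L y k \<notin> T"] by (cases "?k = 0") auto
qed

text \<open>
  A rooted subtree with \<open>n\<close> nodes has \<open>n + 1\<close> children outside of it, if the leaves of the complete
  tree get children as well.
\<close>

lemma card_exits:
  assumes T: "T \<in> rooted_subtrees (Suc L) (0, 0)"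
  shows "card (exits L T) + card (inner_leaves L T) \<le> Suc (card T)"
proof -
  \<comment> \<open>The root is added because it is the exit node if \<open>T\<close> is
    empty.\<close>
  define C where "C = insert (0, 0) (\<Union> (children ` T))"
  have fin: "finite T" and TC: "T \<subseteq> C" and lev: "\<And>l p. (l, p) \<in> T \<Longrightarrow> l \<le> L"
    using finite_subtree[OF T] subtree_parent_closed[OF T] subtree_descendants[OF T]
    by (auto simp: C_def dest!: subsetD descendants_level)
  have "card (\<Union> (children ` T)) \<le> (\<Sum>v\<in>T. card (children v))"
    using fin by (intro card_UN_le)
  also have "\<dots> = 2 * card T"
    by (simp add: children_def case_prod_unfold)
  finally have "card C \<le> Suc (2 * card T)"
    unfolding C_def by (intro order_trans[OF card_insert_le_m1]) auto
  moreover have finC: "finite C"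
    using fin by (auto simp: C_def children_def)
  ultimately have cardC: "card (C - T) \<le> Suc (card T)"
    using TC fin by (simp add: card_Diff_subset)
  \<comment> \<open>Each inner leaf is charged to the first of its two virtual children at level
    \<open>Suc L\<close>. Exits have level at most \<open>L\<close>, so no node is charged
    twice.\<close>
  define g where "g y = (Suc L, 2 * y)" for y :: nat
  have exits: "exits L T \<subseteq> (C - T) \<inter> {(l, p). l \<le> L}"
  proof
    fix v assume "v \<in> exits L T"
    then obtain y where y: "y < 2 ^ L" "y \<notin> inner_leaves L T" "v = exit_node L T y"
      by (auto simp: exits_def)
    obtain k where k: "k \<le> L" "exit_node L T y = path_node L y k" "path_node L y k \<notin> T"
      "k = 0 \<or> path_node L y (k - 1) \<in> T"
      using exit_nodeE[OF T y(1,2)] by blast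
    have "path_node L y k \<in> C"
    proof (cases "k = 0")
      case True
      then show ?thesis using y by (simp add: C_def path_node_0)
    next
      case False
      then obtain j where j: "k = Suc j" "j < L" using k(1) by (cases k) auto
      obtain p where p: "path_node L y j = (j, p)" by (simp add: path_node_def)
      then have "path_node L y k \<in> children (j, p)" "(j, p) \<in> T"
        using path_node_Suc_cases[OF j(2) p] k(4) j by (auto simp: children_def)
      then show ?thesis by (auto simp: C_def)
    qed
    then show "v \<in> (C - T) \<inter> {(l, p). l \<le> L}"
      using k y by (auto simp: path_node_def)
  qed
  have leaves: "g ` inner_leaves L T \<subseteq> (C - T) \<inter> {(l, p). \<not> l \<le> L}"
  proof
    fix v assume "v \<in> g ` inner_leaves L T"
    then obtain y where y: "y \<in> inner_leaves L T" "v = g y" by auto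
    then have "path_node L y L \<in> T" by (auto simp: inner_leaves_def)
    then have "(L, y) \<in> T" by (simp add: path_node_def)
    then have "v \<in> C" using y by (auto simp: C_def children_def g_def)
    then show "v \<in> (C - T) \<inter> {(l, p). \<not> l \<le> L}"
      using y lev[of "Suc L" "2 * y"] by (auto simp: g_def)
  qed
  have "card (exits L T) + card (inner_leaves L T) = card (exits L T) + card (g ` inner_leaves L T)"
    by (subst card_image) (auto simp: inj_on_def g_def)
  also have "\<dots> = card (exits L T \<union> g ` inner_leaves L T)"
    using exits leaves finite_subset[of _ "C - T"] finC by (intro card_Un_disjoint[symmetric]) auto
  also have "\<dots> \<le> card (C - T)"
    using exits leaves finC by (intro card_mono) auto
  finally show ?thesis using cardC by simp
qed

text \<open>
  \<open>T\<close> consists of the full nodes all of whose ancestors are full. A block in the stash or in a bucket of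
  \<open>T\<close> would have been stored deeper unless the full nodes reach down to the place where infinite
  buckets would put it.
\<close>

lemma full_subtree:
  assumes cons: "consistent ops" and lab: "\<And>b z. new_labels ops b = Some z \<Longrightarrow> z < 2 ^ L"
    and c: "c \<in> path_oram L Z ops"
  shows "\<exists>T\<in>rooted_subtrees (Suc L) (0, 0). Z * card T + card (stash c) \<le>
    card {b. \<exists>z. new_labels ops b = Some z \<and> (\<forall>l\<le>L. touches L ops b z l \<longrightarrow> path_node L z l \<in> T)}"
proof -
  interpret oram_inv L Z ops c
    using cons c by (rule oram_inv_path_oram)
  define T where "T = grow (\<lambda>v. Z \<le> card (bucket c v)) (Suc L) (0, 0)"
  define U where "U = {b. \<exists>z. new_labels ops b = Some z \<and> (\<forall>l\<le>L. touches L ops b z l \<longrightarrow> path_node L z l \<in> T)}"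
  have T: "T \<in> rooted_subtrees (Suc L) (0, 0)"
    unfolding T_def by (rule grow_subtree)
  have inT: "path_node L z l \<in> T \<longleftrightarrow> (\<forall>j\<in>{0..l}. Z \<le> card (bucket c (path_node L z j)))"
    if "z < 2 ^ L" "l \<le> L" for z l
    unfolding T_def using that by (intro path_node_in_grow_iff) (auto simp: path_node_0)
  have stash_U: "stash c \<subseteq> U"
  proof
    fix b assume b: "b \<in> stash c"
    then obtain z where z: "label c b = Some z"
      using stash_dom by blast
    have "path_node L z l \<in> T" if "l \<le> L" "touches L ops b z l" for l
      using inT[of z l] full[OF z] touches_mono[OF that(2)] that(1) b lab z label_eq by auto
    then show "b \<in> U"
      using z label_eq by (auto simp: U_def)
  qed
  have bucket_U: "bucket c u \<subseteq> U" if u: "u \<in> T" for u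
  proof
    fix b assume b: "b \<in> bucket c u"
    then obtain z k where z: "label c b = Some z" "k \<le> L" "u = path_node L z k"
      using bucket_path by blast
    then have z_less: "z < 2 ^ L"
      using lab label_eq by auto
    have "path_node L z l \<in> T" if l: "l \<le> L" "touches L ops b z l" for l
      unfolding inT[OF z_less l(1)]
    proof
      fix j assume j: "j \<in> {0..l}"
      show "Z \<le> card (bucket c (path_node L z j))"
      \<comment> \<open>Down to level \<open>k\<close> the nodes are full because they are ancestors
        of \<open>u\<close> or \<open>u\<close> itself; further down \<open>full\<close> applies
        because the block lies above.\<close>
      proof (cases "j \<le> k")
        case True
        then show ?thesis using u inT[OF z_less z(2)] z(3) by simp
      next
        case False
        then have "\<exists>k<j. b \<in> bucket c (path_node L z k)"
          using b z(3) by (intro exI[of _ k]) simp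
        then show ?thesis
          using full[OF z(1), of j] touches_mono[OF l(2), of j] j l(1) by simp
      qed
    qed
    then show "b \<in> U"
      using z label_eq by (auto simp: U_def)
  qed
  have fin_U: "finite U"
    by (rule finite_subset[OF _ finite_new_labels[of ops]]) (auto simp: U_def)
  have fin_T: "finite T"
    using T by (rule finite_subtree)
  have "Z * card T = (\<Sum>u\<in>T. Z)"
    by simp
  also have "\<dots> \<le> (\<Sum>u\<in>T. card (bucket c u))"
    unfolding T_def by (intro sum_mono) (rule grow_holds)
  also have "\<dots> = card (\<Union>u\<in>T. bucket c u)"
    using fin_T finite_subset[OF bucket_U fin_U] bucket_disjoint
    by (intro card_UN_disjoint[symmetric]) auto
  finally have "Z * card T + card (stash c) \<le> card (\<Union>u\<in>T. bucket c u) + card (stash c)"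
    by simp
  also have "\<dots> = card ((\<Union>u\<in>T. bucket c u) \<union> stash c)"
  proof (intro card_Un_disjoint[symmetric])
    show "finite (\<Union>u\<in>T. bucket c u)"
      using fin_T finite_subset[OF bucket_U fin_U] by blast
    show "finite (stash c)"
      using stash_U fin_U by (rule finite_subset)
    show "(\<Union>u\<in>T. bucket c u) \<inter> stash c = {}"
      using stash_disjoint by blast
  qed
  also have "\<dots> \<le> card U"
    using stash_U bucket_U fin_U by (intro card_mono) blast+
  finally show ?thesis
    unfolding U_def using T by blast
qed

subsection \<open>Number of blocks in a subtree\<close>

lemma sum_of_bool_lessThan: "(\<Sum>x<M. of_bool (P x)) = real (card {x. x < M \<and> P x})" for M :: nat
proof -
  have "{x. x < M \<and> P x} = {..<M} \<inter> {x. P x}" by auto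
  then show ?thesis by (simp only: sum_of_bool_eq finite_lessThan)
qed

text \<open>Deleting an element of \<open>S\<close> divides the potential by 3, that is, multiplies
  it by \<open>1 - 2 / 3\<close>.\<close>

lemma sum_potential:
  fixes M :: nat and S :: "'k set" and e :: "nat \<Rightarrow> 'k"
  assumes "finite S"
  shows "(\<Sum>x<M. (3::real) ^ card (S - {e x})) = 3 ^ card S * (real M - 2 / 3 * card {x. x < M \<and> e x \<in> S})"
proof -
  have "3 ^ card (S - {e x}) = (3 ^ card S * (1 - 2 / 3 * of_bool (e x \<in> S)) :: real)" for x
  proof (cases "e x \<in> S")
    case True
    then have "card S = Suc (card (S - {e x}))"
      using assms by (metis card_Suc_Diff1)
    then have "(3 :: real) ^ card S = 3 * 3 ^ card (S - {e x})"
      by (metis power_Suc)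
    then show ?thesis using True by simp
  qed simp
  then have "(\<Sum>x<M. (3::real) ^ card (S - {e x})) =
      3 ^ card S * (\<Sum>x<M. (1 - 2 / 3 * of_bool (e x \<in> S)))"
    by (simp add: sum_distrib_left)
  also have "(\<Sum>x<M. (1 - 2 / 3 * of_bool (e x \<in> S))) = real M - 2 / 3 * (\<Sum>x<M. of_bool (e x \<in> S) :: real)"
    by (simp only: sum_subtractf sum_distrib_left[symmetric]) simp
  also note sum_of_bool_lessThan
  finally show ?thesis .
qed

text \<open>
  One step of the process: the exit above \<open>x\<close> is deleted from the set \<open>S\<close> of exits, then \<open>y\<close> hits a
  remaining exit or an element of \<open>W\<close>. The potential \<open>3 ^ card S\<close> works since
  \<open>(1 + 2/3 p) (1 - 2/3 p) \<le> 1\<close> for the probability \<open>p\<close> that a label lies below an exit in \<open>S\<close>.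
\<close>

lemma potential_step:
  fixes M :: nat and S :: "'k set" and e :: "nat \<Rightarrow> 'k" and W :: "nat set"
  assumes S: "finite S" and M: "0 < M" and W: "W \<subseteq> {..<M}"
  shows "(\<Sum>x<M. \<Sum>y<M. (if y \<in> W \<or> e y \<in> S - {e x} then 5 / 3 else 1) * 3 ^ card (S - {e x}))
     \<le> real M ^ 2 * (3 ^ card S * (1 + 2 / 3 * (real (card W) / real M)))"
proof -
  define q where "q = real (card {y. y < M \<and> e y \<in> S})"
  define w where "w = real (card W)"
  have q: "0 \<le> q" and w: "0 \<le> w" by (auto simp: q_def w_def)
  \<comment> \<open>The factor \<open>5 / 3\<close> is \<open>1 + 2 / 3\<close>, and the two ways of
    being counted are added up; the deletion of \<open>e x\<close> is ignored here and enters
    through the potential.\<close>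
  have inner: "(\<Sum>y<M. (if y \<in> W \<or> e y \<in> S - {e x} then 5 / 3 else 1 :: real)) \<le> M + 2 / 3 * (w + q)" for x
  proof -
    have "(\<Sum>y<M. (if y \<in> W \<or> e y \<in> S - {e x} then 5 / 3 else 1 :: real)) \<le>
        (\<Sum>y<M. 1 + 2 / 3 * (of_bool (y \<in> W) + of_bool (e y \<in> S)))"
      by (intro sum_mono) auto
    also have "\<dots> = M + 2 / 3 * ((\<Sum>y<M. of_bool (y \<in> W)) + (\<Sum>y<M. of_bool (e y \<in> S)))"
      by (simp only: sum.distrib sum_distrib_left[symmetric]) simp
    also have "(\<Sum>y<M. of_bool (y \<in> W) :: real) = w"
      unfolding sum_of_bool_lessThan w_def using W by (auto intro!: arg_cong[where f = card])
    also have "(\<Sum>y<M. of_bool (e y \<in> S) :: real) = q"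
      unfolding sum_of_bool_lessThan q_def ..
    finally show ?thesis .
  qed
  have "(\<Sum>x<M. \<Sum>y<M. (if y \<in> W \<or> e y \<in> S - {e x} then 5 / 3 else 1) * 3 ^ card (S - {e x})) =
      (\<Sum>x<M. (\<Sum>y<M. (if y \<in> W \<or> e y \<in> S - {e x} then 5 / 3 else 1 :: real)) * 3 ^ card (S - {e x}))"
    by (simp add: sum_distrib_right)
  also have "\<dots> \<le> (\<Sum>x<M. (M + 2 / 3 * (w + q)) * 3 ^ card (S - {e x}))"
    by (intro sum_mono mult_right_mono inner) auto
  also have "\<dots> = (M + 2 / 3 * (w + q)) * (3 ^ card S * (real M - 2 / 3 * q))"
    using S by (simp add: q_def sum_potential flip: sum_distrib_left)
  also have "\<dots> = 3 ^ card S * ((M + 2 / 3 * (w + q)) * (real M - 2 / 3 * q))"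
    by (rule mult.left_commute)
  \<comment> \<open>The terms linear in \<open>q\<close> alone cancel, and what is dropped is
    \<open>- 4 / 9 * q * (w + q)\<close>.\<close>
  also have "\<dots> \<le> 3 ^ card S * (real M ^ 2 + 2 / 3 * w * M)"
    using q w by (intro mult_left_mono) (auto simp: algebra_simps power2_eq_square)
  also have "\<dots> = real M ^ 2 * (3 ^ card S * (1 + 2 / 3 * (real (card W) / real M)))"
    using M by (simp add: w_def field_simps power2_eq_square)
  finally show ?thesis .
qed

text \<open>Here \<open>z i\<close> is the pair of old and new label of operation \<open>i\<close>,
  \<open>I\<close> the last accesses, \<open>W\<close> the inner leaves, \<open>e\<close> the exit
  map and \<open>S\<close> the exits not visited by operations with index below \<open>k\<close>.
  The hits are the operations whose blocks lie in the subtree if buckets are unlimited. The case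
  \<open>j = i\<close> is included because operation \<open>i\<close> writes its block back along
  its own read path.\<close>

definition hits :: "nat set \<Rightarrow> (nat \<Rightarrow> 'k) \<Rightarrow> 'k set \<Rightarrow> nat set \<Rightarrow> nat \<Rightarrow> nat \<Rightarrow> (nat \<Rightarrow> nat \<times> nat) \<Rightarrow> nat set" where
  "hits W e S I k m z = {i \<in> I \<inter> {k..<m}. snd (z i) \<in> W \<or>
     e (snd (z i)) \<in> S \<and> e (snd (z i)) \<notin> (\<lambda>j. e (fst (z j))) ` {k..i}}"

lemma hits_Suc:
  assumes "k < m"
  shows "hits W e S I k m (z(k := (x, y))) =
    (if k \<in> I \<and> (y \<in> W \<or> e y \<in> S - {e x}) then {k} else {}) \<union> hits W e (S - {e x}) I (Suc k) m z"
proof (intro set_eqI)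
  fix i
  have img: "(\<lambda>j. e (fst ((z(k := (x, y))) j))) ` {k..i} = insert (e x) ((\<lambda>j. e (fst (z j))) ` {Suc k..i})"
    if "k \<le> i"
  proof -
    have "{k..i} = insert k {Suc k..i}" using that by auto
    then show ?thesis by auto
  qed
  consider "i < k" | "i = k" | "k < i" by linarith
  then show "i \<in> hits W e S I k m (z(k := (x, y))) \<longleftrightarrow>
      i \<in> (if k \<in> I \<and> (y \<in> W \<or> e y \<in> S - {e x}) then {k} else {}) \<union> hits W e (S - {e x}) I (Suc k) m z"
  proof cases
    case 3
    then have "(z(k := (x, y))) i = z i" by simp
    then show ?thesis
      using 3 unfolding hits_def mem_Collect_eq Un_iff img[OF less_imp_le[OF 3]] by auto
  qed (use assms in \<open>auto simp: hits_def\<close>)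
qed

lemma finite_hits [simp]: "finite (hits W e S I k m z)"
  by (simp add: hits_def)

lemma card_hits_Suc:
  assumes "k < m"
  shows "card (hits W e S I k m (z(k := (x, y)))) =
    of_bool (k \<in> I \<and> (y \<in> W \<or> e y \<in> S - {e x})) + card (hits W e (S - {e x}) I (Suc k) m z)"
proof -
  have "k \<notin> hits W e (S - {e x}) I (Suc k) m z" by (simp add: hits_def)
  then show ?thesis by (simp add: hits_Suc[OF assms])
qed

text \<open>Induction that splits off the most recent operation. Its pair of labels is independent
  of the others; its old label shrinks \<open>S\<close>, the induction hypothesis is applied to the
  smaller set, and \<open>potential_step\<close> averages over the pair. Each operation in
  \<open>I\<close> costs one factor coming from \<open>W\<close>.\<close>

lemma expectation_hits:
  fixes M n k :: nat and S :: "'k set" and e :: "nat \<Rightarrow> 'k" and W :: "nat set"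
  assumes S: "finite S" and M: "0 < M" and W: "W \<subseteq> {..<M}"
  shows "(\<integral>\<^sup>+ z. ennreal ((5 / 3) ^ card (hits W e S I k (k + n) z))
      \<partial>Pi_pmf {k..<k + n} d (\<lambda>_. pmf_of_set ({..<M} \<times> {..<M})))
    \<le> ennreal (3 ^ card S * (1 + 2 / 3 * (real (card W) / real M)) ^ card (I \<inter> {k..<k + n}))"
  using S
proof (induction n arbitrary: k S)
  case 0
  have "ennreal 1 \<le> ennreal (3 ^ card S)" by (intro ennreal_leI) simp
  then show ?case by (simp add: hits_def)
next
  case (Suc n)
  let ?u = "pmf_of_set ({..<M} \<times> {..<M})"
  let ?P = "Pi_pmf {Suc k..<Suc k + n} d (\<lambda>_. ?u)"
  let ?h = "1 + 2 / 3 * (real (card W) / real M)"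
  let ?c = "card (I \<inter> {Suc k..<Suc k + n})"
  let ?g = "\<lambda>x y. if k \<in> I \<and> (y \<in> W \<or> e y \<in> S - {e x}) then 5 / 3 else 1 :: real"
  let ?b = "of_bool (k \<in> I) :: nat"
  have h: "1 \<le> ?h" by simp
  have ne: "{..<M} \<times> {..<M} \<noteq> {}" "finite ({..<M} \<times> {..<M})" using M by auto
  have set_eq: "{k..<k + Suc n} = insert k {Suc k..<Suc k + n}" by auto
  have card_eq: "card (I \<inter> {k..<k + Suc n}) = ?b + ?c"
    unfolding set_eq by (auto simp: Int_insert_right)
  have hits_eq: "(5 / 3) ^ card (hits W e S I k (k + Suc n) (z(k := v))) =
      ?g (fst v) (snd v) * (5 / 3) ^ card (hits W e (S - {e (fst v)}) I (Suc k) (Suc k + n) z)" for z v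
    using card_hits_Suc[of k "k + Suc n" W e S I z "fst v" "snd v"] by auto
  have "(\<integral>\<^sup>+ z. ennreal ((5 / 3) ^ card (hits W e S I k (k + Suc n) z))
      \<partial>Pi_pmf {k..<k + Suc n} d (\<lambda>_. ?u)) =
    (\<integral>\<^sup>+ v. \<integral>\<^sup>+ z. ennreal ((5 / 3) ^ card (hits W e S I k (k + Suc n) (z(k := v)))) \<partial>?P \<partial>?u)"
    unfolding set_eq by (subst Pi_pmf_insert) (auto simp: nn_integral_pair_pmf' case_prod_unfold)
  also have "\<dots> = (\<integral>\<^sup>+ v. ennreal (?g (fst v) (snd v)) *
      (\<integral>\<^sup>+ z. ennreal ((5 / 3) ^ card (hits W e (S - {e (fst v)}) I (Suc k) (Suc k + n) z)) \<partial>?P) \<partial>?u)"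
    unfolding hits_eq by (subst ennreal_mult) (auto simp: nn_integral_cmult)
  also have "\<dots> \<le> (\<integral>\<^sup>+ v. ennreal (?g (fst v) (snd v)) * ennreal (3 ^ card (S - {e (fst v)}) * ?h ^ ?c) \<partial>?u)"
    using Suc.prems by (intro nn_integral_mono mult_left_mono Suc.IH) auto
  also have "\<dots> = (\<integral>\<^sup>+ v. ennreal (?g (fst v) (snd v) * (3 ^ card (S - {e (fst v)}) * ?h ^ ?c)) \<partial>?u)"
    by (intro nn_integral_cong ennreal_mult[symmetric]) auto
  also have "\<dots> = (\<Sum>v\<in>{..<M} \<times> {..<M}. ennreal (?g (fst v) (snd v) * (3 ^ card (S - {e (fst v)}) * ?h ^ ?c))) /
      card ({..<M} \<times> {..<M})"
    using ne by (rule nn_integral_pmf_of_set)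
  also have "\<dots> = ennreal ((\<Sum>v\<in>{..<M} \<times> {..<M}. ?g (fst v) (snd v) * (3 ^ card (S - {e (fst v)}) * ?h ^ ?c)) / M ^ 2)"
    using M by (subst sum_ennreal)
      (auto simp: divide_ennreal ennreal_of_nat_eq_real_of_nat power2_eq_square sum_nonneg)
  also have "\<dots> \<le> ennreal (3 ^ card S * ?h ^ (?b + ?c))"
  proof (intro ennreal_leI)
    have "(\<Sum>v\<in>{..<M} \<times> {..<M}. ?g (fst v) (snd v) * (3 ^ card (S - {e (fst v)}) * ?h ^ ?c)) =
        (\<Sum>x<M. \<Sum>y<M. ?g x y * 3 ^ card (S - {e x})) * ?h ^ ?c"
      by (simp add: sum.cartesian_product case_prod_unfold sum_distrib_right mult.assoc)
    also have "\<dots> \<le> (real M ^ 2 * (3 ^ card S * ?h ^ ?b)) * ?h ^ ?c"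
    proof (intro mult_right_mono)
      show "(\<Sum>x<M. \<Sum>y<M. ?g x y * 3 ^ card (S - {e x})) \<le> real M ^ 2 * (3 ^ card S * ?h ^ ?b)"
      proof (cases "k \<in> I")
        case True
        then show ?thesis using potential_step[OF Suc.prems M W, of e] by simp
      next
        case False
        \<comment> \<open>Outside \<open>I\<close> nothing is counted, and deleting an exit can only
          lower the potential.\<close>
        have "(\<Sum>x<M. \<Sum>y<M. 3 ^ card (S - {e x})) \<le> (\<Sum>x<M. \<Sum>y<M. (3 :: real) ^ card S)"
          using Suc.prems by (intro sum_mono power_increasing card_mono) auto
        also have "\<dots> = real M ^ 2 * 3 ^ card S"
          by (simp add: power2_eq_square)
        finally show ?thesis using False by simp
      qed
    qed (use h in auto)
    finally show "(\<Sum>v\<in>{..<M} \<times> {..<M}. ?g (fst v) (snd v) * (3 ^ card (S - {e (fst v)}) * ?h ^ ?c)) / M ^ 2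
        \<le> 3 ^ card S * ?h ^ (?b + ?c)"
      using M by (simp add: field_simps power_add)
  qed
  finally show ?case unfolding card_eq .
qed

subsection \<open>Independence of the labels\<close>

text \<open>Index 1 is the most recent operation, so the last access to an address is the one with
  the smallest index.\<close>

definition last_accesses :: "nat \<Rightarrow> (nat \<Rightarrow> 'a) \<Rightarrow> nat set" where
  "last_accesses s a = {i \<in> {1..s}. \<forall>j\<in>{1..<i}. a j \<noteq> a i}"

lemma card_last_accesses: "card (last_accesses s a) \<le> card (a ` {1..s})"
proof -
  have "inj_on a (last_accesses s a)"
    by (rule linorder_inj_onI) (auto simp: last_accesses_def)
  then have "card (last_accesses s a) = card (a ` last_accesses s a)"
    by (simp add: card_image)
  also have "\<dots> \<le> card (a ` {1..s})"
    by (intro card_mono) (auto simp: last_accesses_def)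
  finally show ?thesis .
qed

text \<open>The index range is a parameter so that inductions can pass to the older
  operations.\<close>

definition operations :: "(nat \<Rightarrow> 'a) \<Rightarrow> (nat \<Rightarrow> nat) \<Rightarrow> (nat \<Rightarrow> nat) \<Rightarrow> nat \<Rightarrow> nat \<Rightarrow> 'a operation list" where
  "operations a x y k m = map (\<lambda>i. (a i, x i, y i)) [k..<m]"

lemma operations_Cons: "k < m \<Longrightarrow> operations a x y k m = (a k, x k, y k) # operations a x y (Suc k) m"
  by (simp add: operations_def upt_conv_Cons)

lemma operations_Nil: "m \<le> k \<Longrightarrow> operations a x y k m = []"
  by (simp add: operations_def)

lemma new_labels_operations:
  assumes "new_labels (operations a x y k m) b = Some z"
  shows "\<exists>i. k \<le> i \<and> i < m \<and> a i = b \<and> z = y i \<and> (\<forall>j\<in>{k..<i}. a j \<noteq> b)"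
  using assms
proof (induction "m - k" arbitrary: k)
  case (Suc n)
  then have k: "k < m" "n = m - Suc k" by auto
  show ?case
  proof (cases "a k = b")
    case True
    then show ?thesis using Suc.prems k by (auto simp: operations_Cons intro!: exI[of _ k])
  next
    case False
    then have "new_labels (operations a x y (Suc k) m) b = Some z"
      using Suc.prems k by (simp add: operations_Cons)
    then obtain i where i: "Suc k \<le> i" "i < m" "a i = b" "z = y i" "\<forall>j\<in>{Suc k..<i}. a j \<noteq> b"
      using Suc.hyps(1)[OF k(2)] by blast
    have "\<forall>j\<in>{k..<i}. a j \<noteq> b"
      using i(5) False by (metis atLeastLessThan_iff le_antisym not_less_eq_eq)
    then show ?thesis using i by (auto intro!: exI[of _ i])
  qed
qed (simp add: operations_Nil)

text \<open>For an address accessed before, \<open>new_labels\<close> of the older operations and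
  \<open>old_label\<close> both pick the nearest older access.\<close>

lemma consistent_operations:
  assumes "\<And>i. k \<le> i \<Longrightarrow> x i = old_label s a y f i"
  shows "consistent (operations a x y k (Suc s))"
  using assms
proof (induction "Suc s - k" arbitrary: k)
  case (Suc n)
  then have k: "k < Suc s" "n = Suc s - Suc k" by auto
  have "z = x k" if new: "new_labels (operations a x y (Suc k) (Suc s)) (a k) = Some z" for z
  proof -
    obtain i where i: "Suc k \<le> i" "i < Suc s" "a i = a k" "z = y i" "\<forall>j\<in>{Suc k..<i}. a j \<noteq> a k"
      using new_labels_operations[OF new] by blast
    have "(LEAST j. k < j \<and> j \<le> s \<and> a j = a k) = i"
      using i by (intro Least_equality) (auto simp: not_less_eq_eq not_less[symmetric])
    moreover have "\<exists>j. k < j \<and> j \<le> s \<and> a j = a k"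
      using i by (intro exI[of _ i]) simp
    ultimately have "old_label s a y f k = y i"
      by (simp add: old_label_def)
    then show ?thesis using i Suc.prems[of k] by simp
  qed
  then show ?case
    using Suc.hyps(1)[OF k(2)] Suc.prems k by (simp add: operations_Cons)
qed (simp add: operations_Nil)

text \<open>No operation more recent than \<open>i\<close> accesses \<open>b\<close>, so the
  recursion of \<open>touches\<close> is not cut off before it reaches \<open>j\<close>.\<close>

lemma touches_operations:
  assumes "k \<le> j" "j \<le> i" "i < m" "\<forall>j\<in>{k..<i}. a j \<noteq> b" "path_node L (x j) l = path_node L z l"
  shows "touches L (operations a x y k m) b z l"
  using assms
proof (induction "m - k" arbitrary: k)
  case (Suc n)
  then have k: "k < m" "n = m - Suc k" by auto
  show ?case
  proof (cases "k = j")
    case True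
    then show ?thesis using Suc.prems k by (simp add: operations_Cons)
  next
    case False
    then have "touches L (operations a x y (Suc k) m) b z l" "a k \<noteq> b"
      using Suc.prems Suc.hyps(1)[OF k(2)] by auto
    then show ?thesis using k by (auto simp: operations_Cons)
  qed
qed simp

text \<open>The access that assigned the label which operation \<open>i\<close> reads. It is
  meaningful for \<open>i\<close> in \<open>repeated\<close>, the operations that are not the first
  in time for their address.\<close>

definition next_older :: "nat \<Rightarrow> (nat \<Rightarrow> 'a) \<Rightarrow> nat \<Rightarrow> nat" where
  "next_older s a i = (LEAST j. i < j \<and> j \<le> s \<and> a j = a i)"

definition repeated :: "nat \<Rightarrow> (nat \<Rightarrow> 'a) \<Rightarrow> nat set" where
  "repeated s a = {i \<in> {1..s}. \<exists>j. i < j \<and> j \<le> s \<and> a j = a i}"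

lemma next_older:
  assumes "i \<in> repeated s a"
  shows "i < next_older s a i" "next_older s a i \<le> s" "a (next_older s a i) = a i"
  using assms LeastI_ex[of "\<lambda>j. i < j \<and> j \<le> s \<and> a j = a i"]
  by (auto simp: repeated_def next_older_def)

lemma next_older_le: "i < j \<Longrightarrow> j \<le> s \<Longrightarrow> a j = a i \<Longrightarrow> next_older s a i \<le> j"
  unfolding next_older_def by (intro Least_le) auto

lemma inj_on_next_older: "inj_on (next_older s a) (repeated s a)"
proof (rule linorder_inj_onI)
  fix i j assume ij: "i < j" "i \<in> repeated s a" "j \<in> repeated s a"
  show "next_older s a i \<noteq> next_older s a j"
  proof
    assume eq: "next_older s a i = next_older s a j"
    then have "a j = a i"
      using next_older(3)[OF ij(2)] next_older(3)[OF ij(3)] by simp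
    then have "next_older s a i \<le> j"
      using ij by (intro next_older_le) (auto simp: repeated_def)
    then show False
      using eq next_older(1)[OF ij(3)] by simp
  qed
qed auto

text \<open>Unless an operation is the last access to its address, the nearest later access reads
  the label that it assigned. So the new labels that get revealed are those of all operations other
  than the last accesses.\<close>

lemma next_older_image: "next_older s a ` repeated s a = {1..s} - last_accesses s a"
proof (intro equalityI subsetI)
  fix j assume "j \<in> next_older s a ` repeated s a"
  then obtain i where i: "i \<in> repeated s a" "j = next_older s a i" by auto
  then have "i \<in> {1..<j}" "a i = a j" "j \<in> {1..s}"
    using next_older[OF i(1)] by (auto simp: repeated_def)
  then show "j \<in> {1..s} - last_accesses s a"
    by (auto simp: last_accesses_def)
next
  fix j assume j: "j \<in> {1..s} - last_accesses s a"
  define I where "I = {i \<in> {1..<j}. a i = a j}"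
  \<comment> \<open>Among the more recent accesses to the same address, the largest index is the one
    nearest in time to \<open>j\<close>.\<close>
  define i where "i = Max I"
  have I: "finite I" "I \<noteq> {}"
    using j by (auto simp: I_def last_accesses_def)
  then have i: "i \<in> I" unfolding i_def by (rule Max_in)
  then have "i \<in> repeated s a"
    using j by (auto simp: I_def repeated_def intro!: exI[of _ j])
  moreover have "next_older s a i = j"
    unfolding next_older_def
  proof (rule Least_equality)
    fix j' assume j': "i < j' \<and> j' \<le> s \<and> a j' = a i"
    show "j \<le> j'"
    proof (rule ccontr)
      assume "\<not> j \<le> j'"
      then have "j' \<in> I" using j' i by (auto simp: I_def)
      then have "j' \<le> i" unfolding i_def using I by (intro Max_ge)
      then show False using j' by simp
    qed
  qed (use i j in \<open>auto simp: I_def\<close>)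
  ultimately show "j \<in> next_older s a ` repeated s a" by force
qed

lemma old_label_eq:
  assumes "i \<in> {1..s}"
  shows "old_label s a y f i = (if i \<in> repeated s a then y (next_older s a i) else f i)"
  using assms by (auto simp: old_label_def repeated_def next_older_def)

text \<open>
  A label \<open>y j\<close> that is revealed by a later operation \<open>i\<close> is exchanged with the unused fresh label
  \<open>f i\<close>. So the old labels, together with the new labels of the last accesses, are independent.
\<close>

definition label_pairs :: "nat \<Rightarrow> (nat \<Rightarrow> 'a) \<Rightarrow> (nat \<Rightarrow> nat) \<times> (nat \<Rightarrow> nat) \<Rightarrow> nat \<Rightarrow> nat \<times> nat" where
  "label_pairs s a = (\<lambda>(y, f) i. if i \<in> {1..s}
     then (old_label s a y f i,
       if i \<in> last_accesses s a then y i else f (inv_into (repeated s a) (next_older s a) i))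
     else (0, 0))"

lemma random_labels_eq: "random_labels L s = pmf_of_set (PiE_dflt {1..s} 0 (\<lambda>_. {0..<2 ^ L}))"
  unfolding random_labels_def by (subst Pi_pmf_of_set) auto

text \<open>Both functions can be read off. On \<open>repeated\<close>, \<open>f\<close> appears as
  second component at \<open>next_older\<close>; elsewhere it is the old label. At last accesses,
  \<open>y\<close> is the second component; elsewhere it is the old label of the operation that
  reveals it.\<close>

lemma inj_on_label_pairs:
  "inj_on (label_pairs s a) (PiE_dflt {1..s} 0 B \<times> PiE_dflt {1..s} 0 B)"
proof (intro inj_onI, clarify)
  fix y f y' f'
  assume in_B: "y \<in> PiE_dflt {1..s} 0 B" "f \<in> PiE_dflt {1..s} 0 B"
    "y' \<in> PiE_dflt {1..s} 0 B" "f' \<in> PiE_dflt {1..s} 0 B"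
    and eq: "label_pairs s a (y, f) = label_pairs s a (y', f')"
  have old: "old_label s a y f i = old_label s a y' f' i" if "i \<in> {1..s}" for i
    using fun_cong[OF eq, of i] that by (simp add: label_pairs_def)
  have new: "y i = y' i" if "i \<in> last_accesses s a" for i
    using fun_cong[OF eq, of i] that by (auto simp: label_pairs_def last_accesses_def)
  have "f i = f' i" if "i \<in> repeated s a" for i
  proof -
    have "next_older s a i \<in> {1..s} - last_accesses s a"
      using that next_older_image[of s a] by blast
    then show ?thesis
      using fun_cong[OF eq, of "next_older s a i"] that
      by (simp add: label_pairs_def inv_into_f_f[OF inj_on_next_older])
  qed
  then have f: "f i = f' i" if "i \<in> {1..s}" for i
    using old[OF that] that by (cases "i \<in> repeated s a") (auto simp: old_label_eq)
  have y: "y j = y' j" if j: "j \<in> {1..s}" for j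
  proof (cases "j \<in> last_accesses s a")
    case False
    then obtain i where i: "i \<in> repeated s a" "j = next_older s a i"
      using j next_older_image[of s a] by blast
    then show ?thesis
      using old[of i] by (auto simp: old_label_eq repeated_def)
  qed (rule new)
  have "y i = y' i \<and> f i = f' i" for i
    using in_B f y by (cases "i \<in> {1..s}") (auto simp: PiE_dflt_def)
  then show "y = y' \<and> f = f'"
    by (simp add: fun_eq_iff)
qed

text \<open>An injection between finite sets of equal size is a bijection and preserves uniformity,
  and the uniform distribution on a product set is a product distribution.\<close>

lemma label_pairs_random_labels:
  "map_pmf (label_pairs s a) (pair_pmf (random_labels L s) (random_labels L s)) =
    Pi_pmf {1..s} (0, 0) (\<lambda>_. pmf_of_set ({..<2 ^ L} \<times> {..<2 ^ L}))"
proof -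
  let ?S = "PiE_dflt {1..s} 0 (\<lambda>_. {0..<2 ^ L}) :: (nat \<Rightarrow> nat) set"
  let ?P = "PiE_dflt {1..s} (0, 0) (\<lambda>_. {..<2 ^ L} \<times> {..<2 ^ L}) :: (nat \<Rightarrow> nat \<times> nat) set"
  have S: "finite ?S" "?S \<noteq> {}" and P: "finite ?P"
    by (auto intro!: finite_PiE_dflt)
  have "card (label_pairs s a ` (?S \<times> ?S)) = card (?S \<times> ?S)"
    by (rule card_image[OF inj_on_label_pairs])
  also have "\<dots> = card ?P"
    by (simp add: card_PiE_dflt card_cartesian_product power_mult_distrib)
  finally have card: "card (label_pairs s a ` (?S \<times> ?S)) = card ?P" .
  have sub: "label_pairs s a ` (?S \<times> ?S) \<subseteq> ?P"
  proof (intro image_subsetI, clarify)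
    fix y f assume yf: "y \<in> ?S" "f \<in> ?S"
    have "old_label s a y f i < 2 ^ L" if "i \<in> {1..s}" for i
      using yf that next_older[of i s a] by (auto simp: old_label_eq PiE_dflt_def)
    moreover have "f (inv_into (repeated s a) (next_older s a) i) < 2 ^ L"
      if "i \<in> {1..s}" "i \<notin> last_accesses s a" for i
    proof -
      have "inv_into (repeated s a) (next_older s a) i \<in> repeated s a"
        using that next_older_image[of s a] by (intro inv_into_into) blast
      then show ?thesis using yf by (auto simp: PiE_dflt_def repeated_def)
    qed
    ultimately show "label_pairs s a (y, f) \<in> ?P"
      using yf by (auto simp: PiE_dflt_def label_pairs_def)
  qed
  have "label_pairs s a ` (?S \<times> ?S) = ?P"
    using card_subset_eq[OF P sub card] .
  moreover have "pair_pmf (random_labels L s) (random_labels L s) = pmf_of_set (?S \<times> ?S)"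
    using S by (intro pmf_eqI) (auto simp: random_labels_eq pmf_pair indicator_def split: prod.splits)
  moreover have "map_pmf (label_pairs s a) (pmf_of_set (?S \<times> ?S)) = pmf_of_set (label_pairs s a ` (?S \<times> ?S))"
    using S by (intro map_pmf_of_set_inj inj_on_label_pairs) auto
  moreover have "Pi_pmf {1..s} (0, 0) (\<lambda>_. pmf_of_set ({..<2 ^ L} \<times> {..<2 ^ L})) = pmf_of_set ?P"
    by (intro Pi_pmf_of_set) (auto simp: lessThan_empty_iff)
  ultimately show ?thesis
    by simp
qed

section \<open>From stash usage to hits, tail bound for one subtree, union bound over all
  subtrees\<close>

text \<open>Each block counted in \<open>full_subtree\<close> is charged to its last access
  \<open>i\<close>. If \<open>y i\<close> is no inner leaf and some old label \<open>x j\<close>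
  with \<open>j \<le> i\<close> had the same exit node, the block would touch this node outside
  \<open>T\<close>, a contradiction. So \<open>i\<close> is a hit.\<close>

lemma stash_usage_le_hits:
  assumes y: "y \<in> PiE_dflt {1..s} 0 (\<lambda>_. {0..<2 ^ L})" and f: "f \<in> PiE_dflt {1..s} 0 (\<lambda>_. {0..<2 ^ L})"
    and c: "c \<in> path_oram L Z (map (\<lambda>i. (a i, old_label s a y f i, y i)) [1..<Suc s])"
  shows "\<exists>T\<in>rooted_subtrees (Suc L) (0, 0). Z * card T + stash_usage c \<le>
    card (hits (inner_leaves L T) (exit_node L T) (exits L T) (last_accesses s a) 1 (1 + s) (label_pairs s a (y, f)))"
proof -
  define x where "x = old_label s a y f"
  define ops where "ops = operations a x y 1 (Suc s)"
  have ops: "c \<in> path_oram L Z ops"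
    using c by (simp add: ops_def operations_def x_def)
  have y_less: "y i < 2 ^ L" if "i \<in> {1..s}" for i
    using y that by (auto simp: PiE_dflt_def)
  have x_less: "x i < 2 ^ L" if "i \<in> {1..s}" for i
    using y f that next_older[of i s a] by (auto simp: x_def old_label_eq PiE_dflt_def)
  have cons: "consistent ops"
    unfolding ops_def by (rule consistent_operations) (simp add: x_def)
  have lab: "z < 2 ^ L" if "new_labels ops b = Some z" for b z
    using new_labels_operations[OF that[unfolded ops_def]] y_less by force
  obtain T where T: "T \<in> rooted_subtrees (Suc L) (0, 0)" and le: "Z * card T + card (stash c) \<le>
    card {b. \<exists>z. new_labels ops b = Some z \<and> (\<forall>l\<le>L. touches L ops b z l \<longrightarrow> path_node L z l \<in> T)}"
    (is "_ \<le> card ?U")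
    using full_subtree[OF cons _ ops] lab by blast
  let ?H = "hits (inner_leaves L T) (exit_node L T) (exits L T) (last_accesses s a) 1 (1 + s) (label_pairs s a (y, f))"
  have "?U \<subseteq> a ` ?H"
  proof clarify
    fix b z assume z: "new_labels ops b = Some z"
      and in_T: "\<forall>l\<le>L. touches L ops b z l \<longrightarrow> path_node L z l \<in> T"
    obtain i where i: "1 \<le> i" "i < Suc s" "a i = b" "z = y i" "\<forall>j\<in>{1..<i}. a j \<noteq> b"
      using new_labels_operations[OF z[unfolded ops_def]] by blast
    then have i_last: "i \<in> last_accesses s a"
      by (auto simp: last_accesses_def)
    have pair: "fst (label_pairs s a (y, f) j) = x j" if "j \<in> {1..s}" for j
      using that by (simp add: label_pairs_def x_def)
    have snd_i: "snd (label_pairs s a (y, f) i) = y i"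
      using i i_last by (simp add: label_pairs_def)
    have "exit_node L T (y i) \<in> exits L T \<and>
        exit_node L T (y i) \<notin> (\<lambda>j. exit_node L T (fst (label_pairs s a (y, f) j))) ` {1..i}"
      if not_leaf: "y i \<notin> inner_leaves L T"
    proof
      show "exit_node L T (y i) \<in> exits L T"
        using y_less[of i] i not_leaf by (auto simp: exits_def)
      show "exit_node L T (y i) \<notin> (\<lambda>j. exit_node L T (fst (label_pairs s a (y, f) j))) ` {1..i}"
      proof
        assume "exit_node L T (y i) \<in> (\<lambda>j. exit_node L T (fst (label_pairs s a (y, f) j))) ` {1..i}"
        then obtain j where j: "j \<in> {1..i}" "exit_node L T (y i) = exit_node L T (x j)"
          using pair i by auto
        obtain k where k: "k \<le> L" "exit_node L T (y i) = path_node L (y i) k" "path_node L (y i) k \<notin> T"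
          using exit_nodeE[OF T _ not_leaf] y_less[of i] i by auto
        \<comment> \<open>A node records its level, so the equal exit nodes are ancestors at the
          same level \<open>k\<close>.\<close>
        have "path_node L (x j) k = path_node L (y i) k"
          using j(2) k(2) by (auto simp: exit_node_def path_node_def)
        then have "touches L ops b (y i) k"
          unfolding ops_def using i j by (intro touches_operations[of 1 j i]) auto
        then show False
          using in_T k i by auto
      qed
    qed
    then have "i \<in> ?H"
      using i i_last snd_i by (auto simp: hits_def)
    then show "b \<in> a ` ?H"
      using i by blast
  qed
  then have "card ?U \<le> card ?H"
    by (meson finite_hits finite_imageI card_mono card_image_le order_trans)
  then show ?thesis
    unfolding stash_usage_def using le by (intro bexI[OF _ T]) (rule order_trans)
qed

text \<open>Markov's inequality for \<open>5 / 3\<close> to the number of hits. At most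
  \<open>2 ^ L\<close> operations are counted, so by \<open>1 + u \<le> exp u\<close> each inner
  leaf costs a factor of at most \<open>exp (2 / 3)\<close>, hence at most 3, the same as an exit.
  \<open>card_exits\<close> bounds the number of both together.\<close>

lemma prob_hits:
  assumes T: "T \<in> rooted_subtrees (Suc L) (0, 0)" and I: "card (I \<inter> {1..s}) \<le> 2 ^ L"
  shows "measure_pmf.prob (Pi_pmf {1..s} d (\<lambda>_. pmf_of_set ({..<2 ^ L} \<times> {..<2 ^ L})))
      {z. t \<le> card (hits (inner_leaves L T) (exit_node L T) (exits L T) I 1 (1 + s) z)}
    \<le> 3 ^ Suc (card T) * (3 / 5) ^ t"
proof -
  let ?P = "Pi_pmf {1..s} d (\<lambda>_. pmf_of_set ({..<2 ^ L} \<times> {..<2 ^ L :: nat}))"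
  let ?W = "inner_leaves L T"
  let ?c = "\<lambda>z. card (hits ?W (exit_node L T) (exits L T) I 1 (1 + s) z)"
  let ?u = "2 / 3 * (real (card ?W) / 2 ^ L)"
  have set_eq: "{1..<1 + s} = {1..s}" by auto
  have "emeasure ?P {z. t \<le> ?c z} = (\<integral>\<^sup>+ z. indicator {z. t \<le> ?c z} z \<partial>?P)"
    by simp
  also have "\<dots> \<le> (\<integral>\<^sup>+ z. ennreal ((3 / 5) ^ t) * ennreal ((5 / 3) ^ ?c z) \<partial>?P)"
  proof (intro nn_integral_mono)
    fix z
    show "indicator {z. t \<le> ?c z} z \<le> ennreal ((3 / 5) ^ t) * ennreal ((5 / 3) ^ ?c z)"
    proof (cases "t \<le> ?c z")
      case True
      then have "(5 / 3) ^ t \<le> (5 / 3 :: real) ^ ?c z"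
        by (intro power_increasing) auto
      then have "(3 / 5) ^ t * (5 / 3) ^ t \<le> (3 / 5) ^ t * (5 / 3 :: real) ^ ?c z"
        by (intro mult_left_mono) auto
      then have "1 \<le> (3 / 5) ^ t * (5 / 3 :: real) ^ ?c z"
        by (simp flip: power_mult_distrib)
      then have "ennreal 1 \<le> ennreal ((3 / 5) ^ t * (5 / 3) ^ ?c z)"
        by (rule ennreal_leI)
      then show ?thesis using True by (simp add: ennreal_mult)
    qed simp
  qed
  also have "\<dots> = ennreal ((3 / 5) ^ t) * (\<integral>\<^sup>+ z. ennreal ((5 / 3) ^ ?c z) \<partial>?P)"
    by (simp add: nn_integral_cmult)
  also have "\<dots> \<le> ennreal ((3 / 5) ^ t) * ennreal (3 ^ card (exits L T) * (1 + ?u) ^ card (I \<inter> {1..s}))"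
  proof (intro mult_left_mono)
    have "finite (exits L T)" "?W \<subseteq> {..<2 ^ L}"
      by (auto simp: exits_def inner_leaves_def)
    then show "(\<integral>\<^sup>+ z. ennreal ((5 / 3) ^ ?c z) \<partial>?P) \<le>
        ennreal (3 ^ card (exits L T) * (1 + ?u) ^ card (I \<inter> {1..s}))"
      using expectation_hits[where S = "exits L T" and M = "2 ^ L" and W = ?W and e = "exit_node L T"
        and I = I and k = 1 and n = s and d = d, unfolded set_eq] by simp
  qed simp
  also have "\<dots> \<le> ennreal ((3 / 5) ^ t) * ennreal (3 ^ Suc (card T))"
  proof (intro mult_left_mono ennreal_leI)
    have "(1 + ?u) ^ card (I \<inter> {1..s}) \<le> (1 + ?u) ^ 2 ^ L"
      using I by (intro power_increasing) auto
    also have "\<dots> \<le> exp ?u ^ 2 ^ L"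
      by (intro power_mono) auto
    also have "\<dots> = exp (2 / 3 * real (card ?W))"
      by (simp flip: exp_of_nat_mult)
    also have "\<dots> \<le> exp 1 ^ card ?W"
      by (simp flip: exp_of_nat_mult)
    also have "\<dots> \<le> 3 ^ card ?W"
      using exp_le by (intro power_mono) auto
    finally have "3 ^ card (exits L T) * (1 + ?u) ^ card (I \<inter> {1..s}) \<le> 3 ^ card (exits L T) * 3 ^ card ?W"
      by simp
    also have "\<dots> \<le> 3 ^ Suc (card T)"
      unfolding power_add[symmetric] using card_exits[OF T] by (intro power_increasing) auto
    finally show "3 ^ card (exits L T) * (1 + ?u) ^ card (I \<inter> {1..s}) \<le> 3 ^ Suc (card T)" .
  qed simp
  also have "\<dots> = ennreal (3 ^ Suc (card T) * (3 / 5) ^ t)"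
    by (subst ennreal_mult[symmetric]) (simp_all add: mult.commute)
  finally show ?thesis
    by (simp add: measure_pmf.emeasure_eq_measure)
qed

theorem theorem1:
  fixes N s L R :: nat and a :: "nat \<Rightarrow> 'a"
  assumes "N \<ge> 1"
    and "card (a ` {1..s}) \<le> N"
    and "L = nat \<lceil>log 2 (real N)\<rceil>"
  shows "measure_pmf.prob (random_operations L s a)
           {ops. \<exists>c \<in> path_oram L 5 ops. stash_usage c > R} \<le> 14 * (0.6002 :: real) ^ R"
proof -
  let ?Q = "pair_pmf (random_labels L s) (random_labels L s)"
  let ?P = "Pi_pmf {1..s} (0, 0) (\<lambda>_. pmf_of_set ({..<2 ^ L} \<times> {..<2 ^ L :: nat}))"
  let ?S = "PiE_dflt {1..s} 0 (\<lambda>_. {0..<2 ^ L}) :: (nat \<Rightarrow> nat) set"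
  let ?I = "last_accesses s a"
  let ?F = "rooted_subtrees (Suc L) (0, 0)"
  \<comment> \<open>Failure means at least \<open>Suc R\<close> blocks in the stash, in addition to
    the \<open>5 * card T\<close> in the buckets of \<open>T\<close>.\<close>
  let ?E = "\<lambda>T. {z. 5 * card T + Suc R \<le>
    card (hits (inner_leaves L T) (exit_node L T) (exits L T) ?I 1 (1 + s) z)}"
  \<comment> \<open>The tree has at least as many leaves as the working set has addresses, which
    bounds the number of last accesses.\<close>
  have "log 2 (real N) \<le> real L"
    using assms(1,3) by (simp add: real_nat_ceiling_ge)
  then have "real N \<le> 2 powr real L"
    using assms(1) by (simp add: log_le_iff)
  then have N: "N \<le> 2 ^ L"
    by (simp add: powr_realpow flip: of_nat_le_iff)
  have "?I \<inter> {1..s} = ?I"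
    by (auto simp: last_accesses_def)
  then have I: "card (?I \<inter> {1..s}) \<le> 2 ^ L"
    using card_last_accesses[of s a] assms(2) N by simp
  have set_Q: "set_pmf ?Q = ?S \<times> ?S"
    by (simp add: random_labels_eq finite_PiE_dflt)
  have "measure_pmf.prob (random_operations L s a) {ops. \<exists>c \<in> path_oram L 5 ops. stash_usage c > R} =
      measure_pmf.prob ?Q {(y, f). \<exists>c \<in> path_oram L 5 (map (\<lambda>i. (a i, old_label s a y f i, y i)) [1..<Suc s]).
        stash_usage c > R}" (is "_ = measure_pmf.prob ?Q ?B")
    unfolding random_operations_def by (simp add: vimage_def case_prod_unfold del: upt_Suc)
  \<comment> \<open>Restricting to the support puts all labels in the range that
    \<open>stash_usage_le_hits\<close> requires.\<close>
  also have "\<dots> = measure_pmf.prob ?Q (?B \<inter> set_pmf ?Q)"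
    by (rule measure_Int_set_pmf[symmetric])
  also have "\<dots> \<le> measure_pmf.prob ?Q (label_pairs s a -` (\<Union>T\<in>?F. ?E T))"
  proof (intro measure_pmf.finite_measure_mono subsetI)
    fix yf assume "yf \<in> ?B \<inter> set_pmf ?Q"
    then obtain y f c where yf: "yf = (y, f)" "y \<in> ?S" "f \<in> ?S" "stash_usage c > R"
      "c \<in> path_oram L 5 (map (\<lambda>i. (a i, old_label s a y f i, y i)) [1..<Suc s])"
      unfolding set_Q by blast
    then obtain T where "T \<in> ?F" "5 * card T + stash_usage c \<le> card (hits (inner_leaves L T)
        (exit_node L T) (exits L T) ?I 1 (1 + s) (label_pairs s a (y, f)))"
      using stash_usage_le_hits by blast
    then show "yf \<in> label_pairs s a -` (\<Union>T\<in>?F. ?E T)"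
      using yf by (intro vimageI2 UN_I[of T]) auto
  qed simp
  also have "\<dots> = measure_pmf.prob ?P (\<Union>T\<in>?F. ?E T)"
    unfolding label_pairs_random_labels[of s a L, symmetric] measure_map_pmf ..
  also have "\<dots> \<le> (\<Sum>T\<in>?F. measure_pmf.prob ?P (?E T))"
    by (intro measure_pmf.finite_measure_subadditive_finite finite_subtrees) auto
  also have "\<dots> \<le> (\<Sum>T\<in>?F. 3 ^ Suc (card T) * (3 / 5) ^ (5 * card T + Suc R))"
    using I by (intro sum_mono prob_hits)
  also have "\<dots> = 9 / 5 * (3 / 5) ^ R * (\<Sum>T\<in>?F. (3 * (3 / 5) ^ 5) ^ card T)"
    unfolding sum_distrib_left by (intro sum.cong) (simp_all add: power_add power_mult power_mult_distrib)
  \<comment> \<open>The ratio \<open>3 * (3 / 5) ^ 5 = 729 / 3125\<close> is below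
    \<open>1 / 4\<close>, as \<open>sum_subtrees_le\<close> requires.\<close>
  also have "\<dots> \<le> 9 / 5 * (3 / 5) ^ R * 2"
    by (intro mult_left_mono sum_subtrees_le) (auto simp: power_divide)
  also have "\<dots> \<le> 14 * (3 / 5) ^ R"
    by simp
  also have "\<dots> \<le> 14 * 0.6002 ^ R"
    by (intro mult_left_mono power_mono) auto
  finally show ?thesis .
qed

end
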